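(* Let $K\in\mathcal{B}(\mathcal{H}_n)$ and let $U$ be a unitary operator on $\mathcal{H}_n$ satisfying $KU=UK$. Then, for any $(N,n)$ $K$-dual pair $(F,G)$, we have $(F,G)\in\mathcal{R}_i$ if and only if $(UF,UG)\in\mathcal{R}_i$, for $i=1,2$.
   Context: $\mathcal{H}_n$ is an $n$-dimensional Hilbert space (over $\mathbb{R}$ or $\mathbb{C}$), $\mathcal{B}(\mathcal{H}_n)$ is the algebra of bounded linear operators on it, and $N$ is a fixed positive integer ($N\ge2$ when two erasures are considered). For $K\in\mathcal{B}(\mathcal{H}_n)$, a sequence $F=\{f_i\}_{i=1}^N\subset\mathcal{H}_n$ is a $K$-frame if there are constants $0<A\le B<\infty$ with $A\|K^*f\|^2\le\sum_{i=1}^N|\langle f,f_i\rangle|^2\le B\|f\|^2$ for all $f\in\mathcal{H}_n$. A sequence $G=\{g_i\}_{i=1}^N\subset\mathcal{H}_n$ is a $K$-dual of the $K$-frame $F$ if $Kf=\sum_{i=1}^N\langle f,g_i\rangle f_i$ for all $f\in\mathcal{H}_n$ (equivalently $K^*f=\sum_{i=1}^N\langle f,f_i\rangle g_i$ for all $f$). In this case $(F,G)$ is called an $(N,n)$ $K$-dual pair for $\mathcal{H}_n$. For an operator $U$, $UF:=\{Uf_i\}_{i=1}^N$ and $UG:=\{Ug_i\}_{i=1}^N$. For a $K$-dual pair $(F,G)$ and $m\in\{1,2\}$, $r_m(F,G)$ is the maximum, over all subsets $\Lambda\subset\{1,\dots,N\}$ with exactly $m$ elements, of the spectral radius (maximum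 modulus of complex eigenvalues) of the error operator $f\mapsto\sum_{i\in\Lambda}\langle f,f_i\rangle g_i$. Set $\tilde r_1:=\inf\{r_1(F,G):(F,G)\text{ is an }(N,n)\ K\text{-dual pair}\}$, $\mathcal{R}_1:=\{(F,G):r_1(F,G)=\tilde r_1\}$, $\tilde r_2:=\inf\{r_2(F,G):(F,G)\in\mathcal{R}_1\}$, and $\mathcal{R}_2:=\{(F,G)\in\mathcal{R}_1:r_2(F,G)=\tilde r_2\}$. *)

theory Defs
  imports "HOL-Analysis.Analysis" "Jordan_Normal_Form.Spectral_Radius"
begin

text \<open>
  The scalar field is the real or the complex numbers. The axioms make \<open>to_complex\<close> an isometric
  embedding of real algebras into the complex numbers, compatible with conjugation, so every
  instance is isomorphic (with its norm and conjugation) to either the reals or the complex numbers.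
\<close>

class real_or_complex = real_normed_field + conjugatable_field +
  fixes to_complex :: "'a \<Rightarrow> complex"
  assumes to_complex_add: "to_complex (x + y) = to_complex x + to_complex y"
    and to_complex_mult: "to_complex (x * y) = to_complex x * to_complex y"
    and to_complex_scaleR: "to_complex (scaleR s x) = scaleR s (to_complex x)"
    and to_complex_1 [simp]: "to_complex 1 = 1"
    and to_complex_conjugate: "to_complex (conjugate x) = cnj (to_complex x)"
    and norm_to_complex: "norm (to_complex x) = norm x"

instantiation real :: real_or_complex
begin
definition to_complex_real :: "real \<Rightarrow> complex" where "to_complex_real x = complex_of_real x"
instance by standard (auto simp: to_complex_real_def scaleR_conv_of_real)
end

instantiation complex :: real_or_complex
begin
definition to_complex_complex :: "complex \<Rightarrow> complex" where "to_complex_complex x = x"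
instance by standard (auto simp: to_complex_complex_def)
end

lemma to_complex_0 [simp]: "to_complex 0 = 0"
  using to_complex_add[of 0 0] by simp

lemma to_complex_of_real: "to_complex (of_real s) = complex_of_real s"
  by (simp add: of_real_def to_complex_scaleR)

lemma to_complex_sum: "to_complex (sum f A) = (\<Sum>x\<in>A. to_complex (f x))"
  by (induction A rule: infinite_finite_induct) (auto simp: to_complex_add)

text \<open>
  Completeness of the inner product space is automatic in finite dimension, so it is not listed.
  The inner product is linear in its first argument.
\<close>

locale hilbert_space = vector_space scale
  for scale :: "'k::real_or_complex \<Rightarrow> 'v::ab_group_add \<Rightarrow> 'v" +
  fixes ip :: "'v \<Rightarrow> 'v \<Rightarrow> 'k"
    and n :: nat
  assumes ip_add_left: "ip (x + y) z = ip x z + ip y z"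
    and ip_scale_left: "ip (scale a x) z = a * ip x z"
    and ip_commute: "ip x y = conjugate (ip y x)"
    and ip_self_nonneg: "\<exists>r\<ge>0. ip x x = of_real r"
    and ip_self_eq_0: "ip x x = 0 \<Longrightarrow> x = 0"
    and dimension_n: "\<exists>B. finite B \<and> card B = n \<and> independent B \<and> span B = UNIV"
begin

definition nrm :: "'v \<Rightarrow> real" where
  "nrm x = sqrt (norm (ip x x))"

definition bounded_operator :: "('v \<Rightarrow> 'v) \<Rightarrow> bool" where
  "bounded_operator T \<longleftrightarrow>
     Vector_Spaces.linear scale scale T \<and> (\<exists>C. \<forall>x. nrm (T x) \<le> C * nrm x)"

text \<open>Existence and uniqueness of the adjoint are shown in \<open>adj\<close> and \<open>adj_unique\<close> below.\<close>

definition adj :: "('v \<Rightarrow> 'v) \<Rightarrow> 'v \<Rightarrow> 'v" where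
  "adj T = (SOME S. \<forall>x y. ip (T x) y = ip x (S y))"

definition unitary_operator :: "('v \<Rightarrow> 'v) \<Rightarrow> bool" where
  "unitary_operator U \<longleftrightarrow> bounded_operator U \<and> adj U \<circ> U = id \<and> U \<circ> adj U = id"

text \<open>
  Sequences indexed by \<open>1, \<dots>, N\<close> are functions on the natural numbers of which only the values on
  \<open>{1..N}\<close> matter.
\<close>

definition K_frame :: "('v \<Rightarrow> 'v) \<Rightarrow> nat \<Rightarrow> (nat \<Rightarrow> 'v) \<Rightarrow> bool" where
  "K_frame K N F \<longleftrightarrow> (\<exists>A B. 0 < A \<and> A \<le> B \<and>
     (\<forall>f. A * (nrm (adj K f))\<^sup>2 \<le> (\<Sum>i = 1..N. (norm (ip f (F i)))\<^sup>2) \<and>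
          (\<Sum>i = 1..N. (norm (ip f (F i)))\<^sup>2) \<le> B * (nrm f)\<^sup>2))"

definition K_dual :: "('v \<Rightarrow> 'v) \<Rightarrow> nat \<Rightarrow> (nat \<Rightarrow> 'v) \<Rightarrow> (nat \<Rightarrow> 'v) \<Rightarrow> bool" where
  "K_dual K N F G \<longleftrightarrow> (\<forall>f. K f = (\<Sum>i = 1..N. scale (ip f (G i)) (F i)))"

definition K_dual_pair :: "('v \<Rightarrow> 'v) \<Rightarrow> nat \<Rightarrow> (nat \<Rightarrow> 'v) \<times> (nat \<Rightarrow> 'v) \<Rightarrow> bool" where
  "K_dual_pair K N = (\<lambda>(F, G). K_frame K N F \<and> K_dual K N F G)"

definition error_operator :: "nat set \<Rightarrow> (nat \<Rightarrow> 'v) \<times> (nat \<Rightarrow> 'v) \<Rightarrow> 'v \<Rightarrow> 'v" where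
  "error_operator \<Lambda> = (\<lambda>(F, G) f. \<Sum>i\<in>\<Lambda>. scale (ip f (F i)) (G i))"

definition ordered_basis :: "'v list \<Rightarrow> bool" where
  "ordered_basis bs \<longleftrightarrow> distinct bs \<and> length bs = n \<and> independent (set bs) \<and> span (set bs) = UNIV"

definition matrix_of :: "'v list \<Rightarrow> ('v \<Rightarrow> 'v) \<Rightarrow> complex mat" where
  "matrix_of bs T = mat n n (\<lambda>(i, j). to_complex (representation (set bs) (T (bs ! j)) (bs ! i)))"

text \<open>
  The complex eigenvalues of an operator are those of its matrix, regarded as a complex matrix;
  for real scalars this includes the non-real eigenvalues. The result does not depend on the
  chosen basis, see \<open>op_spectral_radius_eq\<close>.
\<close>

definition op_spectral_radius :: "('v \<Rightarrow> 'v) \<Rightarrow> real" where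
  "op_spectral_radius T = spectral_radius (matrix_of (SOME bs. ordered_basis bs) T)"

definition r :: "nat \<Rightarrow> nat \<Rightarrow> (nat \<Rightarrow> 'v) \<times> (nat \<Rightarrow> 'v) \<Rightarrow> real" where
  "r N m P = Max {op_spectral_radius (error_operator \<Lambda> P) | \<Lambda>. \<Lambda> \<subseteq> {1..N} \<and> card \<Lambda> = m}"

definition r1_opt :: "('v \<Rightarrow> 'v) \<Rightarrow> nat \<Rightarrow> real" where
  "r1_opt K N = Inf {r N 1 P | P. K_dual_pair K N P}"

definition R1 :: "('v \<Rightarrow> 'v) \<Rightarrow> nat \<Rightarrow> ((nat \<Rightarrow> 'v) \<times> (nat \<Rightarrow> 'v)) set" where
  "R1 K N = {P. K_dual_pair K N P \<and> r N 1 P = r1_opt K N}"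

definition r2_opt :: "('v \<Rightarrow> 'v) \<Rightarrow> nat \<Rightarrow> real" where
  "r2_opt K N = Inf {r N 2 P | P. P \<in> R1 K N}"

definition R2 :: "('v \<Rightarrow> 'v) \<Rightarrow> nat \<Rightarrow> ((nat \<Rightarrow> 'v) \<times> (nat \<Rightarrow> 'v)) set" where
  "R2 K N = {P \<in> R1 K N. r N 2 P = r2_opt K N}"


subsection \<open>Well-definedness of the adjoint\<close>

lemma ip_add_right: "ip x (y + z) = ip x y + ip x z"
  by (metis ip_commute ip_add_left conjugate_dist_add)

lemma ip_scale_right: "ip x (scale a y) = conjugate a * ip x y"
  by (metis ip_commute ip_scale_left conjugate_dist_mul)

lemma ip_diff_right: "ip x (y - z) = ip x y - ip x z"
  by (metis add_diff_cancel_right' diff_add_cancel ip_add_right)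

lemma ip_eqI:
  assumes "\<And>x. ip x y = ip x z"
  shows "y = z"
proof -
  have "ip (y - z) (y - z) = 0" by (simp add: ip_diff_right assms)
  then have "y - z = 0" by (rule ip_self_eq_0)
  then show ?thesis by simp
qed

lemma adj_unique:
  assumes S: "\<forall>x y. ip (T x) y = ip x (S y)"
  shows "adj T = S"
proof (rule ext)
  fix y
  have adj: "\<forall>x y. ip (T x) y = ip x (adj T y)"
    unfolding adj_def
    using someI[where P = "\<lambda>S. \<forall>x y. ip (T x) y = ip x (S y)", OF S] .
  have "ip x (adj T y) = ip x (S y)" for x
    using S[rule_format, of x y] adj[rule_format, of x y] by simp
  then show "adj T y = S y" by (rule ip_eqI)
qed

lemma riesz_span:
  assumes "finite B"
    and "\<And>x y. \<phi> (x + y) = \<phi> x + \<phi> y" and "\<And>a x. \<phi> (scale a x) = a * \<phi> x"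
  shows "\<exists>y\<in>span B. \<forall>x\<in>span B. \<phi> x = ip x y"
  using assms
proof (induction B arbitrary: \<phi> rule: finite_induct)
  case empty
  have "\<phi> 0 = 0" using empty(2)[of 0 0] by simp
  moreover have "ip 0 0 = 0" using ip_add_left[of 0 0 0] by simp
  ultimately show ?case by simp
next
  case (insert v B)
  obtain p where p: "p \<in> span B" "\<And>x. x \<in> span B \<Longrightarrow> ip x v = ip x p"
    using insert.IH[of "\<lambda>x. ip x v"] by (auto simp: ip_add_left ip_scale_left)
  obtain y where y: "y \<in> span B" "\<And>x. x \<in> span B \<Longrightarrow> \<phi> x = ip x y"
    using insert.IH[of \<phi>] insert.prems by auto
  define w where "w = v - p"
  have orth: "ip x w = 0" if "x \<in> span B" for x
    using p(2)[OF that] by (simp add: w_def ip_diff_right)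
  have orth': "ip w x = 0" if "x \<in> span B" for x
    using orth[OF that] ip_commute[of w x] by simp
  define c where "c = conjugate (\<phi> w / ip w w)"
  have w: "w \<in> span (insert v B)"
    unfolding w_def using p(1) span_mono[OF subset_insertI[of B v]]
    by (intro span_diff) (auto intro: span_base)
  have y': "y + scale c w \<in> span (insert v B)"
    using w y(1) span_mono[OF subset_insertI[of B v]]
    by (intro span_add span_scale) auto
  have "\<phi> x = ip x (y + scale c w)" if xin: "x \<in> span (insert v B)" for x
  proof -
    obtain k where "x - scale k v \<in> span B"
      using xin unfolding span_breakdown_eq by blast
    then have s: "x - scale k v + scale k p \<in> span B"
      using p(1) by (simp add: span_add span_scale)
    define s where "s = x - scale k v + scale k p"
    have x: "x = s + scale k w"
      by (simp add: s_def w_def scale_right_diff_distrib)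
    have cw: "conjugate c * ip w w = \<phi> w"
    proof (cases "w = 0")
      case True
      have "\<phi> 0 = 0" using insert.prems(1)[of 0 0] by simp
      moreover have "ip 0 0 = 0" using ip_add_left[of 0 0 0] by simp
      ultimately show ?thesis using True by simp
    next
      case False
      then have "ip w w \<noteq> 0" using ip_self_eq_0 by blast
      then show ?thesis by (simp add: c_def)
    qed
    have "s \<in> span B" using s s_def by simp
    then have "ip x (y + scale c w) = \<phi> s + k * (conjugate c * ip w w)"
      unfolding x using orth orth' y
      by (simp add: ip_add_left ip_add_right ip_scale_left ip_scale_right)
    then show ?thesis
      unfolding cw x by (simp add: insert.prems)
  qed
  then show ?case using y' by blast
qed

lemma adj:
  assumes "Vector_Spaces.linear scale scale T"
  shows "ip (T x) y = ip x (adj T y)"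
proof -
  interpret T: Vector_Spaces.linear scale scale T by fact
  obtain B where B: "finite B" "span B = UNIV" using dimension_n by blast
  have ex: "\<forall>y. \<exists>z. \<forall>x. ip (T x) y = ip x z"
  proof
    fix y
    show "\<exists>z. \<forall>x. ip (T x) y = ip x z"
      using riesz_span[OF B(1), of "\<lambda>x. ip (T x) y"] B(2)
      by (auto simp: T.add T.scale ip_add_left ip_scale_left)
  qed
  obtain S where S: "\<forall>y x. ip (T x) y = ip x (S y)"
    using choice[OF ex] by (rule exE)
  have "adj T = S"
    using S by (intro adj_unique) blast
  moreover have "ip (T x) y = ip x (S y)"
    using S by blast
  ultimately show ?thesis by (simp only:)
qed


subsection \<open>Basis independence of the spectral radius\<close>

lemma ordered_basis_exists: "\<exists>bs. ordered_basis bs"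
proof -
  obtain B where B: "finite B" "card B = n" "independent B" "span B = UNIV"
    using dimension_n by blast
  obtain bs where "set bs = B" "distinct bs"
    using finite_distinct_list[OF B(1)] by blast
  then have "ordered_basis bs"
    unfolding ordered_basis_def using B distinct_card[of bs] by simp
  then show ?thesis ..
qed

lemma ordered_basis_expand:
  assumes "ordered_basis bs"
  shows "(\<Sum>i<n. scale (representation (set bs) v (bs ! i)) (bs ! i)) = v"
proof -
  have bs: "distinct bs" "length bs = n" "independent (set bs)" "span (set bs) = UNIV"
    using assms by (auto simp: ordered_basis_def)
  have "(\<Sum>b\<in>set bs. scale (representation (set bs) v b) b) = v"
    using sum_representation_eq[of "set bs" v "set bs"] bs by simp
  moreover have "bij_betw ((!) bs) {..<n} (set bs)"
    using bij_betw_nth[OF bs(1), of "{..<n}" "set bs"] bs(2) by simp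
  ultimately show ?thesis
    using sum.reindex_bij_betw[of "(!) bs" "{..<n}" "set bs"
        "\<lambda>b. scale (representation (set bs) v b) b"] by simp
qed

lemma representation_linear_expand:
  assumes bs: "ordered_basis bs" and cs: "ordered_basis cs"
    and T: "Vector_Spaces.linear scale scale T"
  shows "representation (set bs) (T v) b =
    (\<Sum>j<n. representation (set cs) v (cs ! j) * representation (set bs) (T (cs ! j)) b)"
proof -
  interpret T: Vector_Spaces.linear scale scale T by fact
  have b: "independent (set bs)" "\<And>x. x \<in> span (set bs)"
    using bs by (auto simp: ordered_basis_def)
  have "T v = (\<Sum>j<n. scale (representation (set cs) v (cs ! j)) (T (cs ! j)))"
    using arg_cong[OF ordered_basis_expand[OF cs, of v], of T, symmetric]
    by (simp add: T.sum T.scale)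
  then show ?thesis
    using b by (simp add: representation_sum representation_scale)
qed

lemma matrix_of_carrier [simp]: "matrix_of bs T \<in> carrier_mat n n"
  by (simp add: matrix_of_def)

lemma op_spectral_radius_eq:
  assumes T: "Vector_Spaces.linear scale scale T" and bs: "ordered_basis bs"
  shows "op_spectral_radius T = spectral_radius (matrix_of bs T)"
proof -
  define cs where "cs = (SOME bs. ordered_basis bs)"
  have cs: "ordered_basis cs"
    unfolding cs_def using ordered_basis_exists by (rule someI_ex)
  define Q where "Q as ds = mat n n (\<lambda>(i, j). to_complex (representation (set as) (ds ! j) (as ! i)))"
    for as ds :: "'v list"
  have id_lin: "Vector_Spaces.linear scale scale (\<lambda>x. x)"
    by (rule linear_ident)
  have Qc [simp]: "Q as ds \<in> carrier_mat n n" for as ds by (simp add: Q_def)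
  have QQ: "Q as ds * Q ds as = 1\<^sub>m n" if a: "ordered_basis as" and d: "ordered_basis ds" for as ds
  proof (rule eq_matI)
    fix i j assume ij: "i < dim_row (1\<^sub>m n)" "j < dim_col (1\<^sub>m n)"
    have as: "distinct as" "length as = n" "independent (set as)"
      using a by (auto simp: ordered_basis_def)
    have "(Q as ds * Q ds as) $$ (i, j) =
       (\<Sum>k<n. to_complex (representation (set ds) (as ! j) (ds ! k) *
            representation (set as) (ds ! k) (as ! i)))"
      using ij by (simp add: Q_def scalar_prod_def to_complex_mult mult.commute lessThan_atLeast0)
    also have "\<dots> = to_complex (representation (set as) (as ! j) (as ! i))"
      using representation_linear_expand[OF a d id_lin, of "as ! j" "as ! i"]
      by (simp add: to_complex_sum)
    also have "\<dots> = 1\<^sub>m n $$ (i, j)"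
      using ij as representation_basis[of "set as" "as ! j"] by (auto simp: nth_eq_iff_index_eq)
    finally show "(Q as ds * Q ds as) $$ (i, j) = 1\<^sub>m n $$ (i, j)" .
  qed (auto simp: Q_def)
  have QM: "Q bs cs * matrix_of cs T = matrix_of bs T * Q bs cs"
  proof (rule eq_matI)
    fix i j assume "i < dim_row (matrix_of bs T * Q bs cs)" "j < dim_col (matrix_of bs T * Q bs cs)"
    then have ij: "i < n" "j < n" by (auto simp: Q_def matrix_of_def)
    have "(Q bs cs * matrix_of cs T) $$ (i, j) = to_complex (\<Sum>k<n.
        representation (set cs) (T (cs ! j)) (cs ! k) * representation (set bs) (cs ! k) (bs ! i))"
      using ij by (simp add: Q_def matrix_of_def scalar_prod_def to_complex_mult to_complex_sum
          mult.commute lessThan_atLeast0)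
    also have "\<dots> = to_complex (representation (set bs) (T (cs ! j)) (bs ! i))"
      using representation_linear_expand[OF bs cs id_lin, of "T (cs ! j)"] by simp
    also have "\<dots> = to_complex (\<Sum>k<n.
        representation (set bs) (cs ! j) (bs ! k) * representation (set bs) (T (bs ! k)) (bs ! i))"
      using representation_linear_expand[OF bs bs T, of "cs ! j"] by simp
    also have "\<dots> = (matrix_of bs T * Q bs cs) $$ (i, j)"
      using ij by (simp add: Q_def matrix_of_def scalar_prod_def to_complex_mult to_complex_sum
          mult.commute lessThan_atLeast0)
    finally show "(Q bs cs * matrix_of cs T) $$ (i, j) = (matrix_of bs T * Q bs cs) $$ (i, j)" .
  qed (auto simp: Q_def matrix_of_def)
  have "matrix_of bs T = matrix_of bs T * (Q bs cs * Q cs bs)"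
    using QQ[OF bs cs] right_mult_one_mat[OF matrix_of_carrier] by simp
  also have "\<dots> = matrix_of bs T * Q bs cs * Q cs bs"
    by (rule assoc_mult_mat[OF matrix_of_carrier Qc Qc, symmetric])
  also have "\<dots> = Q bs cs * matrix_of cs T * Q cs bs"
    by (simp add: QM)
  finally have "similar_mat_wit (matrix_of bs T) (matrix_of cs T) (Q bs cs) (Q cs bs)"
    using QQ[OF bs cs] QQ[OF cs bs]
    by (auto simp: similar_mat_wit_def Let_def matrix_of_def Q_def)
  then have "similar_mat (matrix_of bs T) (matrix_of cs T)"
    by (auto simp: similar_mat_def)
  then have "char_poly (matrix_of bs T) = char_poly (matrix_of cs T)"
    by (rule char_poly_similar)
  then have "spectrum (matrix_of bs T) = spectrum (matrix_of cs T)"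
    unfolding spectrum_root_char_poly[OF matrix_of_carrier] by simp
  then show ?thesis
    unfolding op_spectral_radius_def spectral_radius_def cs_def by simp
qed

end

end

theory Submission
  imports Defs
begin

text \<open>
  Applying a unitary \<open>U\<close> that commutes with \<open>K\<close> to both sequences of a \<open>K\<close>-dual pair yields a
  \<open>K\<close>-dual pair again: moving \<open>U\<close> across the inner product replaces \<open>f\<close> by \<open>adj U f\<close> in the frame
  inequality, and \<open>adj U\<close> preserves norms and commutes with \<open>adj K\<close>, so the same frame bounds work;
  the reconstruction formula turns into \<open>U \<circ> K \<circ> adj U = K\<close>. Each error operator of the new pair is
  the conjugate \<open>U \<circ> E \<circ> adj U\<close> of the old error operator \<open>E\<close>. In the basis that \<open>U\<close> makes out of a
  given one, this conjugate has the same matrix as \<open>E\<close> in the given basis, so the spectral radii,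
  and hence \<open>r N 1\<close> and \<open>r N 2\<close>, agree on the two pairs. The infima \<open>r1_opt\<close> and \<open>r2_opt\<close> do not
  depend on the pair, so optimality of one pair is optimality of the other.
\<close>

context hilbert_space
begin

lemma ordered_basis_map:
  assumes U: "Vector_Spaces.linear scale scale U" and bij: "bij U" and bs: "ordered_basis bs"
  shows "ordered_basis (map U bs)"
proof -
  interpret U: Vector_Spaces.linear scale scale U by fact
  have "inj U" "surj U" using bij by (auto simp: bij_def)
  then show ?thesis
    using bs U.span_image[of "set bs"] U.independent_injective_image[of "set bs"]
    by (auto simp: ordered_basis_def distinct_map intro: inj_on_subset)
qed

text \<open>
  Expanding \<open>U v\<close> by linearity over the images of the basis vectors leaves the coordinates of those
  images in the basis they form themselves, which are Kronecker deltas.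
\<close>

lemma representation_map_basis:
  assumes U: "Vector_Spaces.linear scale scale U" and bij: "bij U" and bs: "ordered_basis bs"
    and i: "i < n"
  shows "representation (set (map U bs)) (U v) (U (bs ! i)) = representation (set bs) v (bs ! i)"
proof -
  have cs: "ordered_basis (map U bs)" by (rule ordered_basis_map[OF U bij bs])
  have len: "length bs = n" and dist: "distinct (map U bs)" and ind: "independent (set (map U bs))"
    using bs cs by (auto simp: ordered_basis_def)
  have delta: "representation (set (map U bs)) (U (bs ! j)) (U (bs ! i)) = (if j = i then 1 else 0)"
    if j: "j < n" for j
  proof -
    have "U (bs ! j) \<in> set (map U bs)" using j len by auto
    moreover have "U (bs ! i) = U (bs ! j) \<longleftrightarrow> i = j"
      using nth_eq_iff_index_eq[OF dist, of i j] i j len by simp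
    ultimately show ?thesis
      using representation_basis[OF ind, of "U (bs ! j)"] by auto
  qed
  have "representation (set (map U bs)) (U v) (U (bs ! i)) =
      (\<Sum>j<n. representation (set bs) v (bs ! j) *
        representation (set (map U bs)) (U (bs ! j)) (U (bs ! i)))"
    by (rule representation_linear_expand[OF cs bs U])
  also have "\<dots> = (\<Sum>j<n. if j = i then representation (set bs) v (bs ! j) else 0)"
    by (intro sum.cong) (auto simp: delta simp del: set_map)
  also have "\<dots> = representation (set bs) v (bs ! i)"
    using i by simp
  finally show ?thesis .
qed

lemma linear_of_inverse:
  assumes U: "Vector_Spaces.linear scale scale U" and VU: "V \<circ> U = id" and UV: "U \<circ> V = id"
  shows "Vector_Spaces.linear scale scale V"
proof -
  interpret U: Vector_Spaces.linear scale scale U by fact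
  have VU': "V (U x) = x" and UV': "U (V x) = x" for x
    using VU UV by (auto dest: fun_cong[of _ _ x])
  have "V (x + y) = V x + V y" for x y
    using VU'[of "V x + V y"] by (simp add: U.add UV')
  moreover have "V (scale c x) = scale c (V x)" for c x
    using VU'[of "scale c (V x)"] by (simp add: U.scale UV')
  ultimately show ?thesis by unfold_locales auto
qed

text \<open>
  Both sides are computed by one and the same matrix, that of \<open>T\<close> in a basis \<open>bs\<close> and that of the
  conjugate in the basis \<open>map U bs\<close>; basis independence of the spectral radius does the rest.
\<close>

lemma op_spectral_radius_conjugation:
  assumes U: "Vector_Spaces.linear scale scale U" and VU: "V \<circ> U = id" and UV: "U \<circ> V = id"
    and T: "Vector_Spaces.linear scale scale T"
  shows "op_spectral_radius (U \<circ> T \<circ> V) = op_spectral_radius T"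
proof -
  obtain bs where bs: "ordered_basis bs" using ordered_basis_exists by blast
  have bij: "bij U" using VU UV by (rule o_bij)
  have cs: "ordered_basis (map U bs)" by (rule ordered_basis_map[OF U bij bs])
  have lin: "Vector_Spaces.linear scale scale (U \<circ> T \<circ> V)"
    using linear_of_inverse[OF U VU UV] T U by (intro Vector_Spaces.linear_compose)
  have VU': "V (U x) = x" for x using VU by (auto dest: fun_cong[of _ _ x])
  have len: "length bs = n" using bs by (simp add: ordered_basis_def)
  have "matrix_of (map U bs) (U \<circ> T \<circ> V) = matrix_of bs T"
    using representation_map_basis[OF U bij bs] len
    by (intro eq_matI) (auto simp: matrix_of_def VU')
  then show ?thesis
    using op_spectral_radius_eq[OF lin cs] op_spectral_radius_eq[OF T bs] by simp
qed

lemma linear_error_operator: "Vector_Spaces.linear scale scale (error_operator \<Lambda> (F, G))"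
  by unfold_locales
    (auto simp: error_operator_def ip_add_left ip_scale_left scale_left_distrib sum.distrib
      scale_sum_right)

lemma unitary_operator_linear:
  "unitary_operator U \<Longrightarrow> Vector_Spaces.linear scale scale U"
  by (simp add: unitary_operator_def bounded_operator_def)

lemma ip_linear_right:
  assumes "Vector_Spaces.linear scale scale U"
  shows "ip x (U y) = ip (adj U x) y"
  using adj[OF assms, of y x] ip_commute[of x "U y"] ip_commute[of "adj U x" y] by simp

lemma nrm_adj_unitary:
  assumes "unitary_operator U"
  shows "nrm (adj U f) = nrm f"
proof -
  have "U (adj U f) = f"
    using assms by (auto simp: unitary_operator_def dest: fun_cong[of _ _ f])
  then show ?thesis
    using ip_linear_right[OF unitary_operator_linear[OF assms], of f "adj U f"]
    by (simp add: nrm_def)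
qed

lemma adj_commute:
  assumes K: "Vector_Spaces.linear scale scale K" and U: "Vector_Spaces.linear scale scale U"
    and comm: "K \<circ> U = U \<circ> K"
  shows "adj K (adj U f) = adj U (adj K f)"
proof (rule ip_eqI)
  fix x
  have "K (U x) = U (K x)" using comm by (auto dest: fun_cong[of _ _ x])
  then show "ip x (adj K (adj U f)) = ip x (adj U (adj K f))"
    by (simp add: adj[OF K, symmetric] adj[OF U, symmetric])
qed

text \<open>
  The frame inequality for the image at \<open>f\<close> is the one for \<open>F\<close> at \<open>adj U f\<close>, so the bounds
  \<open>A\<close> and \<open>B\<close> carry over unchanged.
\<close>

lemma K_frame_unitary_image:
  assumes K: "Vector_Spaces.linear scale scale K" and U: "unitary_operator U"
    and comm: "K \<circ> U = U \<circ> K" and F: "K_frame K N F"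
  shows "K_frame K N (U \<circ> F)"
proof -
  note lin = unitary_operator_linear[OF U]
  obtain A B where AB: "0 < A" "A \<le> B"
    and lower: "\<And>f. A * (nrm (adj K f))\<^sup>2 \<le> (\<Sum>i = 1..N. (norm (ip f (F i)))\<^sup>2)"
    and upper: "\<And>f. (\<Sum>i = 1..N. (norm (ip f (F i)))\<^sup>2) \<le> B * (nrm f)\<^sup>2"
    using F unfolding K_frame_def by blast
  have "A * (nrm (adj K f))\<^sup>2 \<le> (\<Sum>i = 1..N. (norm (ip f ((U \<circ> F) i)))\<^sup>2)" for f
    using lower[of "adj U f"]
    by (simp add: adj_commute[OF K lin comm] nrm_adj_unitary[OF U] ip_linear_right[OF lin])
  moreover have "(\<Sum>i = 1..N. (norm (ip f ((U \<circ> F) i)))\<^sup>2) \<le> B * (nrm f)\<^sup>2" for f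
    using upper[of "adj U f"] by (simp add: nrm_adj_unitary[OF U] ip_linear_right[OF lin])
  ultimately show ?thesis unfolding K_frame_def using AB by blast
qed

lemma K_dual_unitary_image:
  assumes U: "unitary_operator U" and comm: "K \<circ> U = U \<circ> K" and FG: "K_dual K N F G"
  shows "K_dual K N (U \<circ> F) (U \<circ> G)"
  unfolding K_dual_def
proof
  fix f
  interpret U: Vector_Spaces.linear scale scale U by (rule unitary_operator_linear[OF U])
  have "K f = K (U (adj U f))"
    using U by (auto simp: unitary_operator_def dest: fun_cong[of _ _ f])
  also have "\<dots> = U (K (adj U f))"
    using comm by (auto dest: fun_cong[of _ _ "adj U f"])
  also have "\<dots> = U (\<Sum>i = 1..N. scale (ip (adj U f) (G i)) (F i))"
    using FG by (simp add: K_dual_def)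
  also have "\<dots> = (\<Sum>i = 1..N. scale (ip f ((U \<circ> G) i)) ((U \<circ> F) i))"
    by (simp add: U.sum U.scale ip_linear_right[OF unitary_operator_linear[OF U]])
  finally show "K f = (\<Sum>i = 1..N. scale (ip f ((U \<circ> G) i)) ((U \<circ> F) i))" .
qed

lemma error_operator_unitary_image:
  assumes U: "Vector_Spaces.linear scale scale U"
  shows "error_operator \<Lambda> (U \<circ> F, U \<circ> G) = U \<circ> error_operator \<Lambda> (F, G) \<circ> adj U"
proof -
  interpret U: Vector_Spaces.linear scale scale U by fact
  show ?thesis
    by (rule ext) (simp add: error_operator_def U.sum U.scale ip_linear_right[OF U])
qed

lemma r_unitary_image:
  assumes U: "unitary_operator U"
  shows "r N m (U \<circ> F, U \<circ> G) = r N m (F, G)"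
proof -
  note lin = unitary_operator_linear[OF U]
  have "op_spectral_radius (error_operator \<Lambda> (U \<circ> F, U \<circ> G)) =
      op_spectral_radius (error_operator \<Lambda> (F, G))" for \<Lambda>
    unfolding error_operator_unitary_image[OF lin]
    using U by (intro op_spectral_radius_conjugation[OF lin _ _ linear_error_operator])
      (auto simp: unitary_operator_def)
  then show ?thesis by (simp add: r_def)
qed

end

theorem proposition3p12:
  fixes scale :: "'k::real_or_complex \<Rightarrow> 'v::ab_group_add \<Rightarrow> 'v"
    and ip :: "'v \<Rightarrow> 'v \<Rightarrow> 'k"
    and n N :: nat
    and K U :: "'v \<Rightarrow> 'v"
    and F G :: "nat \<Rightarrow> 'v"
  assumes "hilbert_space scale ip n"
    and "N \<ge> 1"
    and "hilbert_space.bounded_operator scale ip K"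
    and "hilbert_space.unitary_operator scale ip U"
    and "K \<circ> U = U \<circ> K"
    and "hilbert_space.K_dual_pair scale ip K N (F, G)"
  shows "((F, G) \<in> hilbert_space.R1 scale ip n K N \<longleftrightarrow>
            (U \<circ> F, U \<circ> G) \<in> hilbert_space.R1 scale ip n K N) \<and>
         (N \<ge> 2 \<longrightarrow>
           ((F, G) \<in> hilbert_space.R2 scale ip n K N \<longleftrightarrow>
            (U \<circ> F, U \<circ> G) \<in> hilbert_space.R2 scale ip n K N))"
proof -
  interpret hilbert_space scale ip n by fact
  have K: "Vector_Spaces.linear scale scale K"
    using assms(3) by (simp add: bounded_operator_def)
  have FG: "K_dual_pair K N (F, G)" by fact
  then have UFG: "K_dual_pair K N (U \<circ> F, U \<circ> G)"
    using K_frame_unitary_image[OF K assms(4,5)] K_dual_unitary_image[OF assms(4,5)]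
    by (simp add: K_dual_pair_def)
  have R1: "(F, G) \<in> R1 K N \<longleftrightarrow> (U \<circ> F, U \<circ> G) \<in> R1 K N"
    using FG UFG by (simp add: R1_def r_unitary_image[OF assms(4)])
  then have "(F, G) \<in> R2 K N \<longleftrightarrow> (U \<circ> F, U \<circ> G) \<in> R2 K N"
    by (simp add: R2_def r_unitary_image[OF assms(4)])
  with R1 show ?thesis by blast
qed

end
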